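(* Let $G$ be a simple graph on $n$ vertices with at least one edge, and let $0=\mu_1\le\mu_2\le\cdots\le\mu_n$ be the eigenvalues of its Laplacian matrix. Let $r\ge 0$ be a real number. If $\frac{\mu_2}{\mu_n}\ge \frac{r}{r+1}$, then $G$ is $r$-tough, i.e. $t(G)\ge r$.
   Context: The Laplacian matrix of $G$ is $L=D-A$ ($D$ diagonal degree matrix, $A$ adjacency matrix); $\mu_i$ is its $i$-th smallest eigenvalue. The toughness of $G=(V,E)$ is $t(G)=\min\{|S|/c(G-S)\}$ over all proper subsets $S\subset V$ such that the subgraph induced on $V\setminus S$ has $c(G-S)>1$ connected components; a complete graph has infinite toughness. $G$ is $r$-tough if $t(G)\ge r$. *)

theory Defs
  imports
    "HOL-Library.Extended_Real"
    "Jordan_Normal_Form.Char_Poly"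
    "Graph_Theory.Graph_Theory"
begin

text \<open>
  A finite simple graph is a \<^locale>\<open>graph\<close>: a finite, loop-free digraph without parallel arcs
  whose arc relation is symmetric, so that an undirected edge is a pair of opposite arcs. Hence
  \<^const>\<open>out_degree\<close> is the ordinary degree of a vertex.

  Matrices are indexed by positions in an enumeration \<open>vs\<close> of the vertices, that is, a list with
  \<open>distinct vs\<close> and \<open>set vs = verts G\<close>.
\<close>

definition adjacency_matrix :: "('a, 'b) pre_digraph \<Rightarrow> 'a list \<Rightarrow> real mat" where
  "adjacency_matrix G vs =
     mat (length vs) (length vs) (\<lambda>(i, j). if vs ! i \<rightarrow>\<^bsub>G\<^esub> vs ! j then 1 else 0)"

definition degree_matrix :: "('a, 'b) pre_digraph \<Rightarrow> 'a list \<Rightarrow> real mat" where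
  "degree_matrix G vs = mat_diag (length vs) (\<lambda>i. real (out_degree G (vs ! i)))"

definition laplacian_matrix :: "('a, 'b) pre_digraph \<Rightarrow> 'a list \<Rightarrow> real mat" where
  "laplacian_matrix G vs = degree_matrix G vs - adjacency_matrix G vs"

text \<open>
  The \<open>i\<close>-th smallest eigenvalue, counted with multiplicity; the index \<open>i\<close> starts at 1.
\<close>

definition laplacian_eigenvalue :: "('a, 'b) pre_digraph \<Rightarrow> 'a list \<Rightarrow> nat \<Rightarrow> real" where
  "laplacian_eigenvalue G vs i =
     sorted_list_of_multiset (proots (char_poly (laplacian_matrix G vs))) ! (i - 1)"

definition connected_components ::
    "('a, 'b) pre_digraph \<Rightarrow> ('a, 'b) pre_digraph set" where
  "connected_components G = {H. pre_digraph.max_subgraph G Digraph_Component.connected H}"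

text \<open>
  For a finite graph the infimum ranges over a finite set, so it is a minimum whenever some \<open>S\<close>
  disconnects the graph. Otherwise the graph is complete and the infimum of the empty set is
  \<open>\<infinity>\<close>. The set \<open>S\<close> may be empty, so a disconnected graph has toughness 0.
\<close>

definition toughness :: "('a, 'b) pre_digraph \<Rightarrow> ereal" where
  "toughness G =
     (INF S \<in> {S. S \<subset> verts G \<and> card (connected_components (G \<restriction> (verts G - S))) > 1}.
        ereal (real (card S) / real (card (connected_components (G \<restriction> (verts G - S))))))"

definition tough :: "real \<Rightarrow> ('a, 'b) pre_digraph \<Rightarrow> bool" where
  "tough r G \<longleftrightarrow> ereal r \<le> toughness G"

end

theory Submission
  imports Defs "Jordan_Normal_Form.Spectral_Radius"
begin

text \<open>
  Let \<open>V - S\<close> have \<open>c \<ge> 2\<close> components and put \<open>s = |S|\<close>, \<open>N = |V - S|\<close>, \<open>n = s + N\<close>. Testing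
  \<open>\<mu>\<^sub>n\<close> on the indicator function of \<open>V - S\<close> bounds the number \<open>E\<close> of edges leaving \<open>S\<close> by
  \<open>n E \<le> \<mu>\<^sub>n N s\<close>, so \<open>n E \<ge> \<mu>\<^sub>2 N (s + c)\<close> suffices: it yields \<open>(s + c) \<mu>\<^sub>2 \<le> s \<mu>\<^sub>n\<close>, which together
  with \<open>r \<mu>\<^sub>n \<le> (r + 1) \<mu>\<^sub>2\<close> gives \<open>s \<ge> r c\<close>.

  If every component \<open>X\<close> sends at least \<open>\<mu>\<^sub>2 |X|\<close> edges to \<open>S\<close>, then \<open>E \<ge> \<mu>\<^sub>2 N\<close> and we are done as
  \<open>n \<ge> s + c\<close>. Otherwise let \<open>X\<close> be a component with fewer edges and let \<open>Y\<close> be the union of the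
  others, so \<open>|Y| \<ge> c - 1\<close>. If \<open>|X| \<le> |Y|\<close>, the function that is \<open>|Y|\<close> on \<open>X\<close>, \<open>-|X|\<close> on \<open>Y\<close> and \<open>0\<close>
  on \<open>S\<close> again shows \<open>E \<ge> \<mu>\<^sub>2 N\<close>. If \<open>|X| > |Y|\<close>, the function that is \<open>1\<close> on \<open>X\<close>, \<open>-1\<close> on \<open>Y\<close> and \<open>0\<close>
  on \<open>S\<close> gives \<open>n E \<ge> \<mu>\<^sub>2 (n N - (|X| - |Y|)\<^sup>2)\<close>, which is large enough.
\<close>

section \<open>Diagonalization of real symmetric matrices\<close>

text \<open>Over the complex numbers an eigenpair \<open>k\<close>, \<open>z\<close> exists.
  Symmetry moves the real matrix to the other side of \<open>z \<bullet>c z\<close>, which turns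
  \<open>k\<close> into \<open>cnj k\<close>, so \<open>k\<close> is real.\<close>

lemma symmetric_real_mat_eigenvector:
  fixes A :: "real mat"
  assumes A: "A \<in> carrier_mat n n" and sym: "transpose_mat A = A" and n: "n > 0"
  obtains e v where "v \<in> carrier_vec n" "v \<bullet> v = 1" "A *\<^sub>v v = e \<cdot>\<^sub>v v"
proof -
  let ?A = "map_mat complex_of_real A"
  have cA: "?A \<in> carrier_mat n n" using A by simp
  have symc: "transpose_mat ?A = ?A"
  proof (rule eq_matI)
    fix i j assume "i < dim_row ?A" "j < dim_col ?A"
    then have ij: "i < n" "j < n" using A by auto
    have "A $$ (j, i) = transpose_mat A $$ (i, j)" using ij A by simp
    then show "transpose_mat ?A $$ (i, j) = ?A $$ (i, j)" using ij A sym by simp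
  qed (use A in auto)
  obtain k where k: "eigenvalue ?A k"
    using spectrum_non_empty[OF cA n] by (auto simp: spectrum_def)
  then obtain z where z: "z \<in> carrier_vec n" "z \<noteq> 0\<^sub>v n" "?A *\<^sub>v z = k \<cdot>\<^sub>v z"
    using cA by (auto simp: eigenvalue_def eigenvector_def)
  have conj: "?A *\<^sub>v conjugate z = conjugate (?A *\<^sub>v z)"
    using A z(1) by (intro eq_vecI) (auto simp: scalar_prod_def)
  have "k * (z \<bullet>c z) = (?A *\<^sub>v z) \<bullet> conjugate z" using z by simp
  also have "\<dots> = z \<bullet> (?A *\<^sub>v conjugate z)"
    using transpose_vec_mult_scalar[OF cA, of "conjugate z" z] symc z(1) by simp
  also have "\<dots> = cnj k * (z \<bullet>c z)"
    unfolding conj z(3) using z(1) by (simp add: conjugate_smult_vec)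
  finally have "k = cnj k" using z by simp
  then have kr: "k = complex_of_real (Re k)" by (simp add: complex_eq_iff)
  \<comment> \<open>The vector \<open>z\<close> may be genuinely complex. A real eigenvector is
    recovered from the fact that \<open>Re k\<close> is a root of the real characteristic
    polynomial.\<close>
  have "poly (char_poly ?A) k = 0" using k eigenvalue_root_char_poly[OF cA] by simp
  then have "poly (map_poly complex_of_real (char_poly A)) (complex_of_real (Re k)) = 0"
    using of_real_hom.char_poly_hom[OF A] kr by metis
  then have "poly (char_poly A) (Re k) = 0" by simp
  then obtain w where w: "w \<in> carrier_vec n" "w \<noteq> 0\<^sub>v n" "A *\<^sub>v w = Re k \<cdot>\<^sub>v w"
    using eigenvalue_root_char_poly[OF A] A by (auto simp: eigenvalue_def eigenvector_def)
  define v where "v = (1 / sqrt (w \<bullet> w)) \<cdot>\<^sub>v w"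
  have pos: "w \<bullet> w > 0" using conjugate_square_greater_0_vec[OF w(1)] w(2) by simp
  show thesis
  proof
    show "v \<in> carrier_vec n" using w by (simp add: v_def)
    show "v \<bullet> v = 1" using w pos by (simp add: v_def)
    show "A *\<^sub>v v = Re k \<cdot>\<^sub>v v"
      using w A by (simp add: v_def mult_mat_vec smult_smult_assoc mult.commute)
  qed
qed

text \<open>For \<open>w = v - e\<close> with \<open>e\<close> the first unit vector, the reflection
  \<open>1 - (2 / q) w w^T\<close> with \<open>q = w \<bullet> w\<close> exchanges \<open>e\<close>
  and \<open>v\<close>, as both have length 1. The case \<open>v = e\<close> is separate because
  then \<open>q = 0\<close>.\<close>

lemma householder_reflection:
  fixes v :: "real vec"
  assumes v: "v \<in> carrier_vec (Suc m)" and unit: "v \<bullet> v = 1"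
  obtains H where "H \<in> carrier_mat (Suc m) (Suc m)" "transpose_mat H = H"
    "H * H = 1\<^sub>m (Suc m)" "H *\<^sub>v unit_vec (Suc m) 0 = v"
proof (cases "v = unit_vec (Suc m) 0")
  case True
  then show thesis by (intro that[of "1\<^sub>m (Suc m)"]) auto
next
  case False
  let ?n = "Suc m"
  define w where "w i = v $ i - (if i = 0 then 1 else 0)" for i
  define q where "q = (\<Sum>i<?n. w i * w i)"
  have "v \<bullet> v = (\<Sum>i<?n. v $ i * v $ i)" using v by (simp add: scalar_prod_def atLeast0LessThan)
  then have vv: "(\<Sum>i<?n. v $ i * v $ i) = 1" using unit by simp
  have "q = (\<Sum>i<?n. v $ i * v $ i - 2 * (if i = 0 then v $ 0 else 0) + (if i = 0 then 1 else 0))"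
    unfolding q_def by (intro sum.cong) (auto simp: w_def algebra_simps)
  also have "\<dots> = 2 - 2 * v $ 0"
    by (simp add: sum.distrib sum_subtractf vv sum_distrib_left[symmetric] del: sum.lessThan_Suc)
  \<comment> \<open>This uses that \<open>v\<close> has length 1. It makes the first column of
    \<open>H\<close> equal to \<open>e + w = v\<close>.\<close>
  finally have q: "q = - 2 * w 0" by (simp add: w_def)
  have "q \<noteq> 0"
  proof
    assume "q = 0"
    then have "\<forall>i\<in>{..<?n}. w i * w i = 0" unfolding q_def by (subst (asm) sum_nonneg_eq_0_iff) auto
    then have "v = unit_vec ?n 0" using v by (intro eq_vecI) (auto simp: w_def split: if_splits)
    with False show False by simp
  qed
  define H where "H = mat ?n ?n (\<lambda>(i, j). (if i = j then 1 else 0) - 2 / q * (w i * w j))"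
  have "(\<Sum>k<?n. H $$ (i, k) * H $$ (k, j)) = (if i = j then 1 else 0)" if ij: "i < ?n" "j < ?n" for i j
  proof -
    have "(\<Sum>k<?n. H $$ (i, k) * H $$ (k, j)) = (\<Sum>k<?n. (if k = i then (if i = j then 1 else 0) else 0)
        - (if k = i then 2 / q * (w i * w j) else 0) - (if k = j then 2 / q * (w i * w j) else 0)
        + (4 / q\<^sup>2 * w i * w j) * (w k * w k))"
      unfolding H_def using ij by (intro sum.cong) (auto simp: algebra_simps power2_eq_square)
    also have "\<dots> = (if i = j then 1 else 0) - 2 * (2 / q * (w i * w j)) + (4 / q\<^sup>2 * w i * w j) * q"
      using ij by (simp only: sum.distrib sum_subtractf sum_distrib_left[symmetric] q_def[symmetric]) simp
    also have "\<dots> = (if i = j then 1 else 0)" using \<open>q \<noteq> 0\<close> by (simp add: power2_eq_square)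
    finally show ?thesis .
  qed
  then have HH: "H * H = 1\<^sub>m ?n"
    by (intro eq_matI) (auto simp: H_def scalar_prod_def atLeast0LessThan)
  have "H $$ (i, 0) = v $ i" if "i < ?n" for i
  proof -
    have "2 / q * (w i * w 0) = - w i" using \<open>q \<noteq> 0\<close> q by (simp add: field_simps)
    then show ?thesis using that by (simp add: H_def w_def)
  qed
  then have "H *\<^sub>v unit_vec ?n 0 = v"
    using v by (intro eq_vecI) (auto simp: H_def)
  moreover have "transpose_mat H = H" by (intro eq_matI) (auto simp: H_def)
  ultimately show thesis using HH by (intro that[of H]) (auto simp: H_def)
qed

text \<open>Deflation: a reflection whose first column is a unit eigenvector splits off a 1 by 1
  block holding the eigenvalue, and the remaining block \<open>C\<close> is symmetric of size
  \<open>m\<close>. The orthogonal matrix is the reflection times the block matrix of 1 and the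
  matrix for \<open>C\<close>.\<close>

lemma symmetric_real_mat_diagonalizable:
  fixes A :: "real mat"
  assumes "A \<in> carrier_mat n n" "transpose_mat A = A"
  shows "\<exists>U d. U \<in> carrier_mat n n \<and> transpose_mat U * U = 1\<^sub>m n \<and> U * transpose_mat U = 1\<^sub>m n
    \<and> A = U * mat_diag n d * transpose_mat U"
  using assms
proof (induction n arbitrary: A)
  case 0
  then show ?case by (intro exI[of _ "1\<^sub>m 0"] exI) auto
next
  case (Suc m)
  let ?n = "Suc m" and ?T = "transpose_mat :: real mat \<Rightarrow> real mat"
  note A = Suc.prems(1) and sym = Suc.prems(2)
  obtain e v where v: "v \<in> carrier_vec ?n" "v \<bullet> v = 1" "A *\<^sub>v v = e \<cdot>\<^sub>v v"
    using symmetric_real_mat_eigenvector[OF A sym] by blast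
  obtain H where H: "H \<in> carrier_mat ?n ?n" "?T H = H" "H * H = 1\<^sub>m ?n" "H *\<^sub>v unit_vec ?n 0 = v"
    using householder_reflection[OF v(1,2)] .
  \<comment> \<open>As \<open>H\<close> is symmetric and its own inverse, \<open>B\<close> is
    symmetric and orthogonally similar to \<open>A\<close>. Its first column is \<open>e\<close>
    times the first unit vector, and by symmetry so is its first row.\<close>
  define B where "B = H * (A * H)"
  have B: "B \<in> carrier_mat ?n ?n" using A H by (auto simp: B_def)
  have symB: "?T B = B"
    unfolding B_def using A H sym by (simp add: transpose_mult[where n = ?n and nc = ?n and nr = ?n])
  have "B *\<^sub>v unit_vec ?n 0 = H *\<^sub>v (A *\<^sub>v (H *\<^sub>v unit_vec ?n 0))"
    using A H(1) by (simp add: B_def assoc_mult_mat_vec[where n\<^sub>1 = ?n and n\<^sub>2 = ?n and n\<^sub>3 = ?n])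
  also have "\<dots> = e \<cdot>\<^sub>v (H *\<^sub>v (H *\<^sub>v unit_vec ?n 0))"
    using H(1,4) v by (simp add: mult_mat_vec)
  also have "H *\<^sub>v (H *\<^sub>v unit_vec ?n 0) = unit_vec ?n 0"
    using H(1,3) by (metis assoc_mult_mat_vec one_mult_mat_vec unit_vec_carrier)
  finally have "B *\<^sub>v unit_vec ?n 0 = e \<cdot>\<^sub>v unit_vec ?n 0" .
  then have "(B *\<^sub>v unit_vec ?n 0) $ i = (e \<cdot>\<^sub>v unit_vec ?n 0) $ i" for i by simp
  then have B0: "B $$ (i, 0) = (if i = 0 then e else 0)" if "i < ?n" for i
    using that B by (auto dest!: meta_spec[of _ i] split: if_splits)
  have B0': "B $$ (0, i) = (if i = 0 then e else 0)" if "i < ?n" for i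
  proof -
    have "B $$ (0, i) = ?T B $$ (i, 0)" using that B by simp
    then show ?thesis using B0[OF that] symB by simp
  qed
  define C where "C = mat m m (\<lambda>(i, j). B $$ (Suc i, Suc j))"
  have C: "C \<in> carrier_mat m m" by (simp add: C_def)
  have "?T C = C"
  proof (rule eq_matI)
    fix i j assume "i < dim_row C" "j < dim_col C"
    then have ij: "i < m" "j < m" by (auto simp: C_def)
    have "B $$ (Suc j, Suc i) = ?T B $$ (Suc i, Suc j)" using ij B by simp
    then show "?T C $$ (i, j) = C $$ (i, j)" using ij symB by (simp add: C_def)
  qed (auto simp: C_def)
  then obtain U d where U: "U \<in> carrier_mat m m" "?T U * U = 1\<^sub>m m" "U * ?T U = 1\<^sub>m m"
    "C = U * mat_diag m d * ?T U"
    using Suc.IH[OF C] by blast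
  have UT: "?T U \<in> carrier_mat m m" using U by simp
  have Z: "four_block_mat (1\<^sub>m 1) (0\<^sub>m 1 m) (0\<^sub>m m 1) (1\<^sub>m m) = (1\<^sub>m ?n :: real mat)"
    by (intro eq_matI) auto
  define V where "V = four_block_mat (1\<^sub>m 1) (0\<^sub>m 1 m) (0\<^sub>m m 1) U"
  define E :: "real mat" where "E = mat 1 1 (\<lambda>_. e)"
  have E: "E \<in> carrier_mat 1 1" "E \<in> carrier_mat (Suc 0) (Suc 0)" by (simp_all add: E_def)
  have UD: "U * mat_diag m d \<in> carrier_mat m m" by (rule mult_carrier_mat[OF U(1) mat_diag_dim])
  have UDU: "U * mat_diag m d * ?T U \<in> carrier_mat m m" by (rule mult_carrier_mat[OF UD UT])
  have UDz: "U * mat_diag m d * 0\<^sub>m m (Suc 0) = 0\<^sub>m m (Suc 0)" by (rule right_mult_zero_mat[OF UD])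
  have dz: "0\<^sub>m (Suc 0) m * mat_diag m d = 0\<^sub>m (Suc 0) m" by (rule left_mult_zero_mat[OF mat_diag_dim])
  define d' where "d' i = (case i of 0 \<Rightarrow> e | Suc j \<Rightarrow> d j)" for i
  have V: "V \<in> carrier_mat ?n ?n" using four_block_carrier_mat[OF one_carrier_mat[of 1] U(1)] by (simp add: V_def)
  have VT: "?T V = four_block_mat (1\<^sub>m 1) (0\<^sub>m 1 m) (0\<^sub>m m 1) (?T U)"
    unfolding V_def by (subst transpose_four_block_mat[where ?nr1.0 = 1 and ?nc1.0 = 1 and ?nr2.0 = m and ?nc2.0 = m]) (use U in auto)
  have D: "mat_diag ?n d' = four_block_mat E (0\<^sub>m 1 m) (0\<^sub>m m 1) (mat_diag m d)"
    by (intro eq_matI) (auto simp: mat_diag_def d'_def E_def split: nat.splits)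
  have Bb: "B = four_block_mat E (0\<^sub>m 1 m) (0\<^sub>m m 1) C"
  proof (rule eq_matI)
    fix i j
    assume "i < dim_row (four_block_mat E (0\<^sub>m 1 m) (0\<^sub>m m 1) C)"
      "j < dim_col (four_block_mat E (0\<^sub>m 1 m) (0\<^sub>m m 1) C)"
    then have "i < ?n" "j < ?n" by (auto simp: C_def E_def)
    then show "B $$ (i, j) = four_block_mat E (0\<^sub>m 1 m) (0\<^sub>m m 1) C $$ (i, j)"
      using B0[of i] B0'[of j] by (cases i; cases j) (auto simp: C_def E_def)
  qed (use B in \<open>auto simp: C_def E_def\<close>)
  note blk = mult_four_block_mat[where ?nr1.0 = 1 and ?nr2.0 = m and ?n1.0 = 1 and ?n2.0 = m and ?nc1.0 = 1 and ?nc2.0 = m]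
  have VTV: "?T V * V = 1\<^sub>m ?n"
    unfolding VT unfolding V_def by (subst blk) (use U UT Z in auto)
  have VVT: "V * ?T V = 1\<^sub>m ?n"
    unfolding VT unfolding V_def by (subst blk) (use U UT Z in auto)
  have DV: "V * mat_diag ?n d' * ?T V = B"
  proof -
    have "V * mat_diag ?n d' = four_block_mat E (0\<^sub>m 1 m) (0\<^sub>m m 1) (U * mat_diag m d)"
      unfolding V_def D by (subst blk) (use U E dz in auto)
    moreover have "\<dots> * ?T V = B"
      unfolding Bb VT U(4) by (subst blk) (use U UT E UDU UDz in auto)
    ultimately show ?thesis by simp
  qed
  let ?W = "H * V"
  have W: "?W \<in> carrier_mat ?n ?n" using H V by simp
  have WT: "?T ?W = ?T V * H" using H V by (simp add: transpose_mult[where n = ?n and nc = ?n and nr = ?n])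
  note car = A B H(1) V transpose_carrier_mat[THEN iffD2, OF V] mat_diag_dim[of ?n d']
  note as = assoc_mult_mat[where ?n\<^sub>1 = ?n and ?n\<^sub>2 = ?n and ?n\<^sub>3 = ?n and ?n\<^sub>4 = ?n]
  have "?T ?W * ?W = ?T V * (H * H * V)" unfolding WT using car by (simp add: as del: assoc_mult_mat)
  then have 1: "?T ?W * ?W = 1\<^sub>m ?n" using H V VTV by simp
  have "?W * ?T ?W = H * (V * ?T V) * H" unfolding WT using car by (simp add: as del: assoc_mult_mat)
  then have 2: "?W * ?T ?W = 1\<^sub>m ?n" using H VVT by simp
  define \<Delta> where "\<Delta> = mat_diag ?n d'"
  have \<Delta>: "\<Delta> \<in> carrier_mat ?n ?n" by (simp add: \<Delta>_def)
  have "?W * \<Delta> * ?T ?W = H * (V * \<Delta> * ?T V) * H"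
    unfolding WT using car \<Delta> by (simp add: as del: assoc_mult_mat)
  also have "\<dots> = H * B * H" unfolding \<Delta>_def DV ..
  also have "\<dots> = (H * H) * A * (H * H)" unfolding B_def using car by (simp add: as del: assoc_mult_mat)
  also have "\<dots> = A" using H A by simp
  finally show ?case using W 1 2 unfolding \<Delta>_def by metis
qed

section \<open>Variational bounds for the second and the last eigenvalue\<close>

text \<open>Deleting one occurrence of the minimum, at position \<open>k\<close>, leaves the entries
  of the sorted list from index 1 on. This allows eigenvalues listed in arbitrary order to be
  compared with the second smallest.\<close>

lemma sort_second_le:
  fixes xs :: "'a::linorder list"
  assumes "length xs \<ge> 2"
  obtains k where "k < length xs" "\<And>i. i < length xs \<Longrightarrow> i \<noteq> k \<Longrightarrow> sort xs ! 1 \<le> xs ! i"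
proof -
  obtain a b zs where z: "sort xs = a # b # zs"
    using assms by (metis (no_types) Suc_le_length_iff length_sort numeral_2_eq_2)
  have "a \<in> set xs" using z by (metis list.set_intros(1) set_sort)
  then obtain us vs where xs: "xs = us @ a # vs" by (meson split_list)
  have "mset (us @ vs) = mset (b # zs)" using z xs
    by (metis add_mset_add_single add_right_cancel mset.simps(2) mset_append mset_sort union_mset_add_mset_right)
  then have "set (us @ vs) = set (b # zs)" by (rule mset_eq_setD)
  moreover have "sorted (a # b # zs)" using z by (metis sorted_sort)
  ultimately have le: "b \<le> c" if "c \<in> set us \<union> set vs" for c using that by auto
  show thesis
  proof
    show "length us < length xs" using xs by simp
    fix i assume i: "i < length xs" "i \<noteq> length us"
    have "xs ! i \<in> set us \<union> set vs"
      using i unfolding xs by (auto simp: nth_append nth_Cons split: nat.splits)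
    then show "sort xs ! 1 \<le> xs ! i" using le z by simp
  qed
qed

lemma proots_prod_list_linear:
  fixes xs :: "'a::idom list"
  shows "proots (\<Prod>a\<leftarrow>xs. [:- a, 1:]) = mset xs"
proof (induction xs)
  case (Cons a xs)
  have "(\<Prod>a\<leftarrow>xs. [:- a, 1:]) \<noteq> 0" by (auto simp: prod_list_zero_iff)
  then show ?case using Cons by (simp add: proots_mult del: mult_pCons_left)
qed simp

context
  fixes A :: "real mat" and n :: nat and es :: "real list"
  assumes A: "A \<in> carrier_mat n n" and sym: "transpose_mat A = A"
  defines "es \<equiv> sorted_list_of_multiset (proots (char_poly A))"
begin

text \<open>The matrix \<open>W\<close> is the transpose of the diagonalizing matrix, so
  \<open>W *\<^sub>v x\<close> lists the coordinates of \<open>x\<close> in an orthonormal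
  eigenbasis. By similarity to a diagonal matrix, the characteristic polynomial is a product of
  linear factors with roots \<open>d i\<close>.\<close>

lemma symmetric_real_mat_spectral:
  obtains W d where "W \<in> carrier_mat n n" "es = sort (map d [0..<n])"
    "\<And>x y. x \<in> carrier_vec n \<Longrightarrow> y \<in> carrier_vec n \<Longrightarrow> x \<bullet> y = (\<Sum>i<n. (W *\<^sub>v x) $ i * (W *\<^sub>v y) $ i)"
    "\<And>x y. x \<in> carrier_vec n \<Longrightarrow> y \<in> carrier_vec n \<Longrightarrow>
      x \<bullet> (A *\<^sub>v y) = (\<Sum>i<n. d i * ((W *\<^sub>v x) $ i * (W *\<^sub>v y) $ i))"
    "\<And>x i. x \<in> carrier_vec n \<Longrightarrow> i < n \<Longrightarrow> (W *\<^sub>v (A *\<^sub>v x)) $ i = d i * (W *\<^sub>v x) $ i"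
proof -
  obtain U d where U: "U \<in> carrier_mat n n" "transpose_mat U * U = 1\<^sub>m n" "U * transpose_mat U = 1\<^sub>m n"
    and AU: "A = U * mat_diag n d * transpose_mat U"
    using symmetric_real_mat_diagonalizable[OF A sym] by blast
  define W where "W = transpose_mat U"
  have W: "W \<in> carrier_mat n n" using U by (simp add: W_def)
  have "similar_mat A (mat_diag n d)"
    unfolding similar_mat_def
    by (intro exI, rule similar_mat_witI[OF U(3,2) AU A _ U(1)]) (use U in auto)
  then have "char_poly A = char_poly (mat_diag n d)" by (rule char_poly_similar)
  also have "\<dots> = (\<Prod>a\<leftarrow>diag_mat (mat_diag n d). [:- a, 1:])"
    by (rule char_poly_upper_triangular[where n = n]) (auto simp: mat_diag_def)
  also have "diag_mat (mat_diag n d) = map d [0..<n]" by (auto simp: diag_mat_def mat_diag_def)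
  finally have es: "es = sort (map d [0..<n])"
    by (simp only: es_def proots_prod_list_linear sorted_list_of_multiset_mset)
  have dot: "x \<bullet> y = (\<Sum>i<n. (W *\<^sub>v x) $ i * (W *\<^sub>v y) $ i)"
    if xy: "x \<in> carrier_vec n" "y \<in> carrier_vec n" for x y
  proof -
    have "(W *\<^sub>v x) \<bullet> (W *\<^sub>v y) = x \<bullet> (U *\<^sub>v (W *\<^sub>v y))"
      unfolding W_def by (rule transpose_vec_mult_scalar[OF U(1)]) (use U xy in auto)
    also have "U *\<^sub>v (W *\<^sub>v y) = y"
      using U(1,3) W xy unfolding W_def by (metis assoc_mult_mat_vec one_mult_mat_vec)
    finally show ?thesis using W xy by (simp add: scalar_prod_def atLeast0LessThan)
  qed
  have WA: "(W *\<^sub>v (A *\<^sub>v x)) $ i = d i * (W *\<^sub>v x) $ i"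
    if x: "x \<in> carrier_vec n" and i: "i < n" for x i
  proof -
    have "W * A = mat_diag n d * W"
    proof -
      have "W * A = W * (U * (mat_diag n d * W))" unfolding AU W_def using U
        by (simp add: assoc_mult_mat[where ?n\<^sub>1 = n and ?n\<^sub>2 = n and ?n\<^sub>3 = n and ?n\<^sub>4 = n])
      also have "\<dots> = (W * U) * (mat_diag n d * W)" using U W
        by (intro assoc_mult_mat[symmetric, where ?n\<^sub>1 = n and ?n\<^sub>2 = n and ?n\<^sub>3 = n and ?n\<^sub>4 = n])
          (auto intro!: mult_carrier_mat[OF mat_diag_dim])
      also have "\<dots> = mat_diag n d * W"
        using U(2) W left_mult_one_mat[OF mult_carrier_mat[OF mat_diag_dim W], of d] by (simp add: W_def)
      finally show ?thesis .
    qed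
    then have "W *\<^sub>v (A *\<^sub>v x) = mat_diag n d *\<^sub>v (W *\<^sub>v x)"
      using W A x by (metis assoc_mult_mat_vec mat_diag_dim)
    moreover have "(mat_diag n d *\<^sub>v y) $ i = d i * y $ i" if "y \<in> carrier_vec n" for y
      using that i unfolding mat_diag_def
      by (simp add: scalar_prod_def atLeast0LessThan if_distrib[of "\<lambda>c. c * _"] cong: if_cong)
    ultimately show ?thesis using W x by simp
  qed
  have form: "x \<bullet> (A *\<^sub>v y) = (\<Sum>i<n. d i * ((W *\<^sub>v x) $ i * (W *\<^sub>v y) $ i))"
    if xy: "x \<in> carrier_vec n" "y \<in> carrier_vec n" for x y
    using dot[of x "A *\<^sub>v y"] WA[OF xy(2)] A xy by (simp add: ac_simps)
  show thesis by (rule that[OF W es dot form WA])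
qed

lemma symmetric_real_mat_form_le_last:
  assumes x: "x \<in> carrier_vec n"
  shows "x \<bullet> (A *\<^sub>v x) \<le> es ! (n - 1) * (x \<bullet> x)"
proof -
  obtain W d where W: "W \<in> carrier_mat n n" and es: "es = sort (map d [0..<n])"
    and dot: "\<And>x y. x \<in> carrier_vec n \<Longrightarrow> y \<in> carrier_vec n \<Longrightarrow>
      x \<bullet> y = (\<Sum>i<n. (W *\<^sub>v x) $ i * (W *\<^sub>v y) $ i)"
    and form: "\<And>x y. x \<in> carrier_vec n \<Longrightarrow> y \<in> carrier_vec n \<Longrightarrow>
      x \<bullet> (A *\<^sub>v y) = (\<Sum>i<n. d i * ((W *\<^sub>v x) $ i * (W *\<^sub>v y) $ i))"
    and WA: "\<And>x i. x \<in> carrier_vec n \<Longrightarrow> i < n \<Longrightarrow> (W *\<^sub>v (A *\<^sub>v x)) $ i = d i * (W *\<^sub>v x) $ i"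
    by (fact symmetric_real_mat_spectral)
  have "d i \<le> es ! (n - 1)" if "i < n" for i
  proof -
    have "d i \<in> set es" using es that by simp
    moreover have len: "length es = n" using es by simp
    ultimately obtain j where "j < n" "es ! j = d i" by (metis in_set_conv_nth)
    moreover have "sorted es" using es by simp
    ultimately show ?thesis using len sorted_nth_mono[of es j "n - 1"] by simp
  qed
  then show ?thesis unfolding dot[OF x x] form[OF x x] sum_distrib_left
    by (intro sum_mono mult_right_mono) auto
qed

text \<open>If the second eigenvalue is positive, then \<open>z\<close> spans the kernel and is a multiple of one
  vector of the eigenbasis; otherwise the bound is trivial.\<close>

lemma symmetric_real_mat_form_ge_second:
  assumes psd: "\<And>y. y \<in> carrier_vec n \<Longrightarrow> y \<bullet> (A *\<^sub>v y) \<ge> 0" and n: "n \<ge> 2"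
    and z: "z \<in> carrier_vec n" "z \<noteq> 0\<^sub>v n" "A *\<^sub>v z = 0\<^sub>v n"
    and x: "x \<in> carrier_vec n" and orth: "z \<bullet> x = 0"
  shows "es ! 1 * (x \<bullet> x) \<le> x \<bullet> (A *\<^sub>v x)"
proof (cases "es ! 1 \<le> 0")
  case True
  have "x \<bullet> x \<ge> 0" using conjugate_square_ge_0_vec[of x] by simp
  then have "es ! 1 * (x \<bullet> x) \<le> 0" using True by (simp add: mult_nonpos_nonneg)
  then show ?thesis using psd[OF x] by simp
next
  case False
  obtain W d where W: "W \<in> carrier_mat n n" and es: "es = sort (map d [0..<n])"
    and dot: "\<And>x y. x \<in> carrier_vec n \<Longrightarrow> y \<in> carrier_vec n \<Longrightarrow>
      x \<bullet> y = (\<Sum>i<n. (W *\<^sub>v x) $ i * (W *\<^sub>v y) $ i)"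
    and form: "\<And>x y. x \<in> carrier_vec n \<Longrightarrow> y \<in> carrier_vec n \<Longrightarrow>
      x \<bullet> (A *\<^sub>v y) = (\<Sum>i<n. d i * ((W *\<^sub>v x) $ i * (W *\<^sub>v y) $ i))"
    and WA: "\<And>x i. x \<in> carrier_vec n \<Longrightarrow> i < n \<Longrightarrow> (W *\<^sub>v (A *\<^sub>v x)) $ i = d i * (W *\<^sub>v x) $ i"
    by (fact symmetric_real_mat_spectral)
  obtain k where k: "k < n" and ge: "\<And>i. i < n \<Longrightarrow> i \<noteq> k \<Longrightarrow> es ! 1 \<le> d i"
    using sort_second_le[of "map d [0..<n]"] n unfolding es by auto
  \<comment> \<open>For \<open>i \<noteq> k\<close> the eigenvalue \<open>d i\<close> is at least
    the positive number \<open>es ! 1\<close>, while \<open>A\<close> annihilates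
    \<open>z\<close>.\<close>
  have z0: "(W *\<^sub>v z) $ i = 0" if "i < n" "i \<noteq> k" for i
  proof -
    have "d i * (W *\<^sub>v z) $ i = (W *\<^sub>v 0\<^sub>v n) $ i" using WA[OF z(1) that(1)] z(3) by simp
    also have "\<dots> = 0" using W that(1) by simp
    finally show ?thesis using ge[OF that] False by simp
  qed
  have single: "z \<bullet> y = (W *\<^sub>v z) $ k * (W *\<^sub>v y) $ k" if "y \<in> carrier_vec n" for y
  proof -
    have "z \<bullet> y = (\<Sum>i<n. if i = k then (W *\<^sub>v z) $ k * (W *\<^sub>v y) $ k else 0)"
      unfolding dot[OF z(1) that] using z0 by (intro sum.cong) auto
    then show ?thesis using k by simp
  qed
  have "z \<bullet> z \<noteq> 0" using conjugate_square_eq_0_vec[OF z(1)] z(2) by simp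
  \<comment> \<open>Orthogonality to \<open>z\<close> removes the coordinate at \<open>k\<close>,
    the only one whose eigenvalue may lie below \<open>es ! 1\<close>.\<close>
  then have xk: "(W *\<^sub>v x) $ k = 0" using single[OF x] single[OF z(1)] orth by auto
  show ?thesis unfolding dot[OF x x] form[OF x x] sum_distrib_left
  proof (rule sum_mono)
    fix i assume "i \<in> {..<n}"
    then show "es ! 1 * ((W *\<^sub>v x) $ i * (W *\<^sub>v x) $ i) \<le> d i * ((W *\<^sub>v x) $ i * (W *\<^sub>v x) $ i)"
      using ge[of i] xk by (cases "i = k") (auto intro: mult_right_mono)
  qed
qed

end

section \<open>Edge counts between the parts of a separation\<close>

definition cut_weight :: "('a \<Rightarrow> 'a \<Rightarrow> real) \<Rightarrow> 'a set \<Rightarrow> 'a set \<Rightarrow> real" where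
  "cut_weight w X Y = (\<Sum>x\<in>X. \<Sum>y\<in>Y. w x y)"

text \<open>Division by 2 compensates for the double sum, which meets each unordered pair twice. For
  adjacency weights this is the quadratic form of the Laplacian.\<close>

definition dirichlet_energy :: "('a \<Rightarrow> 'a \<Rightarrow> real) \<Rightarrow> 'a set \<Rightarrow> ('a \<Rightarrow> real) \<Rightarrow> real" where
  "dirichlet_energy w V \<phi> = (\<Sum>u\<in>V. \<Sum>v\<in>V. w u v * (\<phi> u - \<phi> v)\<^sup>2) / 2"

text \<open>Differences vanish inside each part and weights vanish between \<open>X\<close> and
  \<open>Y\<close>, so only pairs with exactly one end in \<open>S\<close> contribute.\<close>

lemma dirichlet_energy_three_parts:
  assumes fin: "finite X" "finite Y" "finite S"
    and disj: "X \<inter> Y = {}" "X \<inter> S = {}" "Y \<inter> S = {}"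
    and sym: "\<And>u v. w u v = w v u"
    and XY: "\<And>u v. u \<in> X \<Longrightarrow> v \<in> Y \<Longrightarrow> w u v = 0"
  shows "dirichlet_energy w (X \<union> Y \<union> S) (\<lambda>u. if u \<in> X then a else if u \<in> Y then b else 0)
    = a\<^sup>2 * cut_weight w X S + b\<^sup>2 * cut_weight w Y S"
proof -
  define \<phi> where "\<phi> u = (if u \<in> X then a else if u \<in> Y then b else 0)" for u
  define E where "E A B = (\<Sum>u\<in>A. \<Sum>v\<in>B. w u v * (\<phi> u - \<phi> v)\<^sup>2)" for A B
  have Esym: "E A B = E B A" for A B
  proof -
    have "E A B = (\<Sum>v\<in>B. \<Sum>u\<in>A. w u v * (\<phi> u - \<phi> v)\<^sup>2)" unfolding E_def by (rule sum.swap)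
    also have "\<dots> = E B A"
      unfolding E_def by (intro sum.cong refl) (simp add: sym power2_commute)
    finally show ?thesis .
  qed
  have const: "E A B = (c - d)\<^sup>2 * cut_weight w A B"
    if "\<And>u. u \<in> A \<Longrightarrow> \<phi> u = c" "\<And>u. u \<in> B \<Longrightarrow> \<phi> u = d" for A B c d
    using that by (simp add: E_def cut_weight_def sum_distrib_left mult.commute[of "w _ _"])
  have X: "\<phi> u = a" if "u \<in> X" for u using that by (simp add: \<phi>_def)
  have Y: "\<phi> u = b" if "u \<in> Y" for u using that disj by (auto simp: \<phi>_def)
  have S: "\<phi> u = 0" if "u \<in> S" for u using that disj by (auto simp: \<phi>_def)
  have EXY: "E X Y = 0" by (simp add: E_def XY)
  have split: "sum f (X \<union> Y \<union> S) = sum f X + sum f Y + sum f S" for f :: "'a \<Rightarrow> real"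
  proof -
    have "sum f (X \<union> Y \<union> S) = sum f (X \<union> Y) + sum f S"
      using fin disj by (intro sum.union_disjoint) auto
    also have "sum f (X \<union> Y) = sum f X + sum f Y"
      using fin disj by (intro sum.union_disjoint) auto
    finally show ?thesis .
  qed
  have "2 * dirichlet_energy w (X \<union> Y \<union> S) \<phi> =
      E X X + E X Y + E X S + (E Y X + E Y Y + E Y S) + (E S X + E S Y + E S S)"
    by (simp add: dirichlet_energy_def split sum.distrib E_def)
  also have "\<dots> = 2 * (a\<^sup>2 * cut_weight w X S + b\<^sup>2 * cut_weight w Y S)"
    using const[of X a X a, OF X X] const[of Y b Y b, OF Y Y] const[of S 0 S 0, OF S S]
      const[of X a S 0, OF X S] const[of Y b S 0, OF Y S] EXY
      Esym[of Y X] Esym[of S X] Esym[of S Y] by simp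
  finally show ?thesis unfolding \<phi>_def by simp
qed

text \<open>The numbers \<open>x\<close>, \<open>y\<close>, \<open>s\<close> are the sizes of the parts \<open>X\<close>, \<open>Y\<close>, \<open>S\<close>, and \<open>p\<close>, \<open>q\<close> are the numbers of
  edges from \<open>X\<close> and \<open>Y\<close> to \<open>S\<close>. The alternative \<open>x \<le> y \<or> y + 1 \<le> x\<close> is where the
  integrality of the sizes enters.\<close>

lemma three_part_bound:
  fixes x y s c p q \<mu> M :: real
  assumes pos: "x \<ge> 1" "y \<ge> 1" "s \<ge> 0" "\<mu> \<ge> 0" and c: "c \<le> y + 1"
    and xy: "x \<le> y \<or> y + 1 \<le> x"
    and low: "\<And>a b. \<mu> * ((x + y + s) * (a\<^sup>2 * x + b\<^sup>2 * y) - (a * x + b * y)\<^sup>2)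
      \<le> (x + y + s) * (a\<^sup>2 * p + b\<^sup>2 * q)"
    and up: "(x + y + s) * (p + q) \<le> M * ((x + y + s) * (x + y) - (x + y)\<^sup>2)"
    and pq: "p \<le> \<mu> * x \<or> \<mu> * (x + y) \<le> p + q"
  shows "(s + c) * \<mu> \<le> s * M"
proof -
  have n: "x + y + s > 0" using pos by linarith
  have large: "\<mu> * (x + y) * (s + c) \<le> (x + y + s) * (p + q)" if "\<mu> * (x + y) \<le> p + q"
  proof -
    have "\<mu> * (x + y) * (s + c) \<le> \<mu> * (x + y) * (x + y + s)"
      using pos c by (intro mult_left_mono) auto
    also have "\<dots> \<le> (p + q) * (x + y + s)" using that n by (intro mult_right_mono) auto
    finally show ?thesis by (simp add: mult.commute)
  qed
  have "\<mu> * (x + y) * (s + c) \<le> (x + y + s) * (p + q)"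
  proof (cases "\<mu> * (x + y) \<le> p + q")
    case False
    then have p: "p \<le> \<mu> * x" using pq by simp
    have "\<not> x \<le> y"
    proof
      assume le: "x \<le> y"
      \<comment> \<open>The choice \<open>a = y\<close>, \<open>b = -x\<close> has mean zero, so the
        subtracted square disappears.\<close>
      have "(x + y + s) * (\<mu> * (y\<^sup>2 * x + x\<^sup>2 * y)) \<le> (x + y + s) * (y\<^sup>2 * p + x\<^sup>2 * q)"
        using low[of y "-x"] by (simp add: algebra_simps)
      then have "\<mu> * (y\<^sup>2 * x + x\<^sup>2 * y) \<le> y\<^sup>2 * p + x\<^sup>2 * q" using n by simp
      then have *: "y\<^sup>2 * (\<mu> * x - p) \<le> x\<^sup>2 * (q - \<mu> * y)" by (simp add: algebra_simps)
      \<comment> \<open>The deficit \<open>\<mu> * x - p\<close> is nonnegative, so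
        \<open>x \<le> y\<close> permits replacing the coefficient \<open>y\<^sup>2\<close> by
        \<open>x\<^sup>2\<close>; then \<open>x\<^sup>2\<close> cancels.\<close>
      have "x\<^sup>2 * (\<mu> * x - p) \<le> y\<^sup>2 * (\<mu> * x - p)"
        using le pos p by (intro mult_right_mono power_mono) auto
      with * have "x\<^sup>2 * (\<mu> * x - p) \<le> x\<^sup>2 * (q - \<mu> * y)" by linarith
      then have "\<mu> * x - p \<le> q - \<mu> * y" using pos by simp
      with False show False by (simp add: algebra_simps)
    qed
    then have ge: "y + 1 \<le> x" using xy by simp
    \<comment> \<open>These two products add up to the slack in
      \<open>(x - y)\<^sup>2 \<le> (x + y) * (x - 1)\<close>. Since \<open>c \<le> y + 1\<close>,
      the right side is at most \<open>(x + y) * (x + y - c)\<close>, which is what the choice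
      \<open>a = 1\<close>, \<open>b = -1\<close> requires.\<close>
    have "(x - (y + 1)) * (3 * y - 1) \<ge> 0" "(2 * y - 1) * (y + 1) \<ge> 0"
      using ge pos by (intro mult_nonneg_nonneg; simp)+
    moreover have "(x + y) * (x - 1) - (x - y)\<^sup>2
        = (x - (y + 1)) * (3 * y - 1) + (2 * y - 1) * (y + 1)"
      by (simp add: power2_eq_square algebra_simps)
    ultimately have "(x - y)\<^sup>2 \<le> (x + y) * (x - 1)" by linarith
    also have "\<dots> \<le> (x + y) * (x + y - c)" using pos c by (intro mult_left_mono) auto
    finally have "(x + y) * (s + c) \<le> (x + y + s) * (x + y) - (x - y)\<^sup>2" by (simp add: algebra_simps)
    from mult_left_mono[OF this pos(4)] show ?thesis using low[of 1 "-1"] by (simp add: mult.assoc)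
  qed (rule large)
  also note up
  also have "M * ((x + y + s) * (x + y) - (x + y)\<^sup>2) = (x + y) * (s * M)"
    by (simp add: power2_eq_square algebra_simps)
  finally have "(x + y) * ((s + c) * \<mu>) \<le> (x + y) * (s * M)" by (simp add: algebra_simps)
  then show ?thesis using pos by simp
qed

text \<open>The hypotheses \<open>low\<close> and \<open>up\<close> are spectral bounds for
  arbitrary, not necessarily centred, functions. They are applied only to functions constant on
  \<open>X\<close>, on \<open>Y\<close> and zero on \<open>S\<close>, which reduces the claim to
  \<open>three_part_bound\<close>.\<close>

lemma separation_bound:
  fixes w :: "'a \<Rightarrow> 'a \<Rightarrow> real" and \<mu> M :: real
  assumes fin: "finite V" and S: "S \<subseteq> V"
    and Un: "\<Union>\<C> = V - S" and ne: "{} \<notin> \<C>" and c2: "card \<C> \<ge> 2"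
    and disj: "\<And>A B. A \<in> \<C> \<Longrightarrow> B \<in> \<C> \<Longrightarrow> A \<noteq> B \<Longrightarrow> A \<inter> B = {}"
    and sep: "\<And>A B u v. A \<in> \<C> \<Longrightarrow> B \<in> \<C> \<Longrightarrow> A \<noteq> B \<Longrightarrow> u \<in> A \<Longrightarrow> v \<in> B \<Longrightarrow> w u v = 0"
    and sym: "\<And>u v. w u v = w v u" and "\<mu> \<ge> 0"
    and low: "\<And>\<phi> :: 'a \<Rightarrow> real. \<mu> * (card V * (\<Sum>u\<in>V. (\<phi> u)\<^sup>2) - (\<Sum>u\<in>V. \<phi> u)\<^sup>2) \<le> card V * dirichlet_energy w V \<phi>"
    and up: "\<And>\<phi> :: 'a \<Rightarrow> real. card V * dirichlet_energy w V \<phi> \<le> M * (card V * (\<Sum>u\<in>V. (\<phi> u)\<^sup>2) - (\<Sum>u\<in>V. \<phi> u)\<^sup>2)"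
  shows "(card S + card \<C>) * \<mu> \<le> card S * M"
proof -
  have sub: "A \<subseteq> V - S" if "A \<in> \<C>" for A using that Un by blast
  have finA: "finite A" if "A \<in> \<C>" for A using sub[OF that] fin by (meson finite_Diff finite_subset)
  have fC: "finite \<C>" using c2 card.infinite by fastforce
  then have "\<C> \<noteq> {}" using c2 by auto
  \<comment> \<open>A class with fewer than \<open>\<mu> * card X\<close> edges to \<open>S\<close>
    is taken if there is one; otherwise any class serves and all of them satisfy the reverse
    bound.\<close>
  obtain X where X: "X \<in> \<C>"
    and Xmin: "cut_weight w X S < \<mu> * card X \<or> (\<forall>A\<in>\<C>. \<mu> * card A \<le> cut_weight w A S)"
    using \<open>\<C> \<noteq> {}\<close> by (metis ex_in_conv not_le)
  define Y where "Y = \<Union>(\<C> - {X})"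
  have XY: "X \<inter> Y = {}" using disj X by (auto simp: Y_def)
  have V: "V = X \<union> Y \<union> S" using Un S X by (auto simp: Y_def)
  have d: "X \<inter> S = {}" "Y \<inter> S = {}" using sub X by (auto simp: Y_def)
  have f: "finite X" "finite Y" "finite S" using fin V by (auto intro: finite_subset)
  have "card Y = (\<Sum>A\<in>\<C> - {X}. card A)"
    unfolding Y_def using finA disj by (intro card_Union_disjoint) (auto simp: pairwise_def disjnt_def)
  also have "\<dots> \<ge> (\<Sum>A\<in>\<C> - {X}. 1)"
    using finA ne by (intro sum_mono) (metis DiffD1 One_nat_def Suc_leI card_gt_0_iff)
  \<comment> \<open>The classes other than \<open>X\<close> are disjoint and nonempty. With at least
    two classes this also gives \<open>card Y \<ge> 1\<close>.\<close>
  finally have cY: "card \<C> \<le> card Y + 1" using X fC by simp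
  have cX: "card X \<ge> 1" using X ne f by (metis One_nat_def Suc_leI card_gt_0_iff)
  have cV: "real (card V) = real (card X) + real (card Y) + real (card S)"
    unfolding V using f d XY by (simp add: card_Un_disjoint Int_Un_distrib2)
  have Ycut: "\<mu> * card Y \<le> cut_weight w Y S" if "\<forall>A\<in>\<C>. \<mu> * card A \<le> cut_weight w A S"
  proof -
    have "\<mu> * card Y = (\<Sum>A\<in>\<C> - {X}. \<mu> * card A)"
      unfolding \<open>card Y = _\<close> by (simp add: sum_distrib_left)
    also have "\<dots> \<le> (\<Sum>A\<in>\<C> - {X}. cut_weight w A S)" using that by (intro sum_mono) auto
    also have "\<dots> = cut_weight w Y S"
      unfolding cut_weight_def Y_def using finA disj by (subst sum.Union_disjoint) auto
    finally show ?thesis .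
  qed
  define \<phi> where "\<phi> a b u = (if u \<in> X then a else if u \<in> Y then b else (0::real))" for a b u
  have split: "sum f V = sum f X + sum f Y + sum f S" for f :: "'a \<Rightarrow> real"
    unfolding V using f d XY by (simp add: sum.union_disjoint Int_Un_distrib2)
  have val: "\<phi> a b u = a" if "u \<in> X" for a b u using that by (simp add: \<phi>_def)
  have val2: "\<phi> a b u = b" if "u \<in> Y" for a b u using that XY by (auto simp: \<phi>_def)
  have val3: "\<phi> a b u = 0" if "u \<in> S" for a b u using that d by (auto simp: \<phi>_def)
  have s1: "(\<Sum>u\<in>V. \<phi> a b u) = a * card X + b * card Y" for a b
    unfolding split by (simp add: val val2 val3)
  have s2: "(\<Sum>u\<in>V. (\<phi> a b u)\<^sup>2) = a\<^sup>2 * card X + b\<^sup>2 * card Y" for a b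
    unfolding split by (simp add: val val2 val3)
  have XY0: "w u v = 0" if "u \<in> X" "v \<in> Y" for u v using that X sep by (auto simp: Y_def)
  have en: "dirichlet_energy w V (\<phi> a b) = a\<^sup>2 * cut_weight w X S + b\<^sup>2 * cut_weight w Y S" for a b
    unfolding V \<phi>_def by (rule dirichlet_energy_three_parts[OF f XY d sym XY0])
  have "(real (card S) + real (card \<C>)) * \<mu> \<le> real (card S) * M"
  proof (rule three_part_bound)
    show "real (card X) \<le> real (card Y) \<or> real (card Y) + 1 \<le> real (card X)"
      by (cases "card X \<le> card Y") auto
    show "cut_weight w X S \<le> \<mu> * card X \<or>
        \<mu> * (real (card X) + real (card Y)) \<le> cut_weight w X S + cut_weight w Y S"
      using Xmin Ycut X by (fastforce simp: distrib_left)
    fix a b :: real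
    show "\<mu> * ((real (card X) + real (card Y) + real (card S)) * (a\<^sup>2 * real (card X) + b\<^sup>2 * real (card Y))
        - (a * real (card X) + b * real (card Y))\<^sup>2)
      \<le> (real (card X) + real (card Y) + real (card S)) * (a\<^sup>2 * cut_weight w X S + b\<^sup>2 * cut_weight w Y S)"
      using low[of "\<phi> a b"] unfolding s1 s2 en cV .
    show "(real (card X) + real (card Y) + real (card S)) * (cut_weight w X S + cut_weight w Y S)
      \<le> M * ((real (card X) + real (card Y) + real (card S)) * (real (card X) + real (card Y))
        - (real (card X) + real (card Y))\<^sup>2)"
      using up[of "\<phi> 1 1"] unfolding s1 s2 en cV by simp
  qed (use cX cY c2 \<open>\<mu> \<ge> 0\<close> in auto)
  then show ?thesis by simp
qed

section \<open>Components of symmetric digraphs\<close>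

lemma (in wf_digraph) strongly_connected_imp_connected:
  "strongly_connected G \<Longrightarrow> connected G"
  unfolding connected_def strongly_connected_def
  by (auto intro: reachable_mk_symmetricI)

text \<open>Maximality ranges over all subgraphs, including those that are not symmetric, where
  connectedness need not be strong. Passing to the subgraph induced on the same vertices restores
  symmetry, so both notions have the same maximal subgraphs.\<close>

lemma (in sym_digraph) connected_components_eq_sccs: "connected_components G = sccs"
proof -
  have conn: "connected H" if "strongly_connected H" "subgraph H G" for H
  proof -
    interpret H: wf_digraph H using that(2) by blast
    show ?thesis using that(1) by (rule H.strongly_connected_imp_connected)
  qed
  have sconn: "strongly_connected H" if "connected H" "induced_subgraph H G" for H
  proof -
    interpret H: sym_digraph H using that(2) by (rule induced_graph_imp_graph)
    show ?thesis using H.sym_arcs that(1) by (rule H.symmetric_connected_imp_strongly_connected)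
  qed
  \<comment> \<open>Adding arcs on a fixed vertex set preserves connectedness, so a connected
    subgraph can be replaced by the one induced on its vertices.\<close>
  have mono: "arc_mono connected"
    unfolding arc_mono_def
    by (metis spanning_def subgraphE wf_digraph.connected_spanning_imp_connected)
  have sc: "strongly_connected (G \<restriction> verts H)" if "connected H" "subgraph H G" for H
  proof -
    have "connected (G \<restriction> verts H)" "induced_subgraph (G \<restriction> verts H) G"
      using mono[unfolded arc_mono_def, rule_format, of H "G \<restriction> verts H"] that
        subgraph_induce_subgraphI2[OF that(2)] by (auto simp: induced_induce)
    then show ?thesis by (rule sconn)
  qed
  have "max_subgraph connected H \<longleftrightarrow> max_subgraph strongly_connected H" for H
  proof
    assume H: "max_subgraph connected H"
    have ind: "induced_subgraph H G" using H mono by (rule induced_subgraphI_arc_mono)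
    have "strongly_connected H" using sconn max_subgraph_prop[OF H] ind by simp
    then show "max_subgraph strongly_connected H"
      using H conn by (auto simp: max_subgraph_def)
  next
    assume H: "max_subgraph strongly_connected H"
    then have HG: "subgraph H G" "connected H"
      using conn by (auto simp: max_subgraph_def)
    show "max_subgraph connected H"
    proof (rule max_subgraphI[where P = connected, OF HG(2,1)])
      fix K assume K: "H \<noteq> K" "subgraph H K" "subgraph K G"
      let ?I = "G \<restriction> verts K"
      have I: "subgraph K ?I" "subgraph ?I G"
        using K subgraph_induce_subgraphI2 by (auto intro: subgraph_induce_subgraphI)
      show "\<not> connected K"
      proof
        assume "connected K"
        then have "strongly_connected ?I" using sc K by simp
        moreover have "subgraph H ?I" using K(2) I(1) subgraph_trans by blast
        \<comment> \<open>Maximality of \<open>H\<close> collapses the chain \<open>H\<close>,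
          \<open>K\<close>, \<open>?I\<close> of nested subgraphs.\<close>
        ultimately have "?I = H" using H I(2) by (auto simp: max_subgraph_def)
        then have "K = H"
          using K(2) I(1) by (auto simp: subgraph_def compatible_def)
        with K(1) show False by simp
      qed
    qed
  qed
  then show ?thesis by (simp add: connected_components_def sccs_altdef2)
qed

section \<open>The Laplacian quadratic form\<close>

definition edge_weight :: "('a, 'b) pre_digraph \<Rightarrow> 'a \<Rightarrow> 'a \<Rightarrow> real" where
  "edge_weight G u v = (if u \<rightarrow>\<^bsub>G\<^esub> v then 1 else 0)"

lemma dirichlet_energy_nonneg:
  assumes "\<And>u v. w u v \<ge> 0"
  shows "dirichlet_energy w V \<phi> \<ge> 0"
  using assms by (auto simp: dirichlet_energy_def intro!: sum_nonneg)

lemma dirichlet_energy_shift: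
  "dirichlet_energy w V (\<lambda>u. \<phi> u - c) = dirichlet_energy w V \<phi>"
  by (simp add: dirichlet_energy_def)

lemma (in sym_digraph) edge_weight_sym: "edge_weight G u v = edge_weight G v u"
  using sym_arcs by (auto simp: edge_weight_def intro: arcs_ends_symmetric)

text \<open>Without parallel arcs, \<open>head G\<close> is injective on the arcs leaving
  \<open>u\<close>, so these arcs correspond to the neighbours of \<open>u\<close>.\<close>

lemma (in graph) out_degree_eq_sum: "real (out_degree G u) = (\<Sum>v\<in>verts G. edge_weight G u v)"
proof -
  have "inj_on (head G) (out_arcs G u)"
    by (rule inj_onI) (auto intro: no_multi_arcs simp: arc_to_ends_def)
  moreover have "head G ` out_arcs G u = {v \<in> verts G. u \<rightarrow>\<^bsub>G\<^esub> v}"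
    by (auto simp: arcs_ends_conv image_iff)
  ultimately have "out_degree G u = card {v \<in> verts G. u \<rightarrow>\<^bsub>G\<^esub> v}"
    unfolding out_degree_def by (metis card_image)
  then show ?thesis by (simp add: edge_weight_def sum.If_cases Int_def)
qed

context graph
begin

context
  fixes vs :: "'a list"
  assumes vs: "distinct vs" "set vs = verts G"
begin

lemma length_enum: "length vs = card (verts G)"
  using distinct_card[OF vs(1)] vs(2) by simp

lemma sum_enum: "(\<Sum>i<length vs. f (vs ! i)) = sum f (verts G)"
  using sum.reindex_bij_betw[OF bij_betw_nth[OF vs(1) refl vs(2)[symmetric]]] .

lemma laplacian_carrier: "laplacian_matrix G vs \<in> carrier_mat (length vs) (length vs)"
  unfolding laplacian_matrix_def by (rule minus_carrier_mat) (simp add: adjacency_matrix_def)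

lemma laplacian_entry:
  assumes "i < length vs" "j < length vs"
  shows "laplacian_matrix G vs $$ (i, j) =
    (if i = j then real (out_degree G (vs ! i)) else 0) - edge_weight G (vs ! i) (vs ! j)"
  using assms
  by (simp add: laplacian_matrix_def degree_matrix_def adjacency_matrix_def mat_diag_def edge_weight_def)

lemma laplacian_sym: "transpose_mat (laplacian_matrix G vs) = laplacian_matrix G vs"
proof (rule eq_matI)
  fix i j assume "i < dim_row (laplacian_matrix G vs)" "j < dim_col (laplacian_matrix G vs)"
  then have "i < length vs" "j < length vs" using laplacian_carrier by auto
  then show "transpose_mat (laplacian_matrix G vs) $$ (i, j) = laplacian_matrix G vs $$ (i, j)"
    using laplacian_carrier laplacian_entry[of i j] laplacian_entry[of j i] edge_weight_sym by auto
qed (use laplacian_carrier in auto)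

lemma laplacian_mult:
  assumes i: "i < length vs"
  shows "(laplacian_matrix G vs *\<^sub>v vec (length vs) (\<lambda>i. \<phi> (vs ! i))) $ i =
    (\<Sum>v\<in>verts G. edge_weight G (vs ! i) v * (\<phi> (vs ! i) - \<phi> v))"
proof -
  let ?n = "length vs" and ?L = "laplacian_matrix G vs" and ?w = "edge_weight G (vs ! i)"
  have "(?L *\<^sub>v vec ?n (\<lambda>i. \<phi> (vs ! i))) $ i = (\<Sum>j<?n. ?L $$ (i, j) * \<phi> (vs ! j))"
    using laplacian_carrier i by (auto simp: scalar_prod_def atLeast0LessThan intro!: sum.cong)
  also have "\<dots> = (\<Sum>j<?n. (if j = i then real (out_degree G (vs ! i)) * \<phi> (vs ! i) else 0)
      - ?w (vs ! j) * \<phi> (vs ! j))"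
    using i by (intro sum.cong) (auto simp: laplacian_entry left_diff_distrib)
  also have "\<dots> = real (out_degree G (vs ! i)) * \<phi> (vs ! i) - (\<Sum>v\<in>verts G. ?w v * \<phi> v)"
    using i by (simp add: sum_subtractf sum_enum[of "\<lambda>v. ?w v * \<phi> v"])
  finally show ?thesis
    by (simp add: out_degree_eq_sum sum_distrib_right right_diff_distrib sum_subtractf)
qed

lemma laplacian_form:
  "vec (length vs) (\<lambda>i. \<phi> (vs ! i)) \<bullet> (laplacian_matrix G vs *\<^sub>v vec (length vs) (\<lambda>i. \<phi> (vs ! i)))
    = dirichlet_energy (edge_weight G) (verts G) \<phi>"
proof -
  let ?n = "length vs" and ?w = "edge_weight G" and ?V = "verts G"
  define a where "a = (\<Sum>u\<in>?V. \<Sum>v\<in>?V. ?w u v * (\<phi> u * \<phi> u))"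
  define b where "b = (\<Sum>u\<in>?V. \<Sum>v\<in>?V. ?w u v * (\<phi> u * \<phi> v))"
  have "vec ?n (\<lambda>i. \<phi> (vs ! i)) \<bullet> (laplacian_matrix G vs *\<^sub>v vec ?n (\<lambda>i. \<phi> (vs ! i)))
      = (\<Sum>i<?n. \<phi> (vs ! i) * (laplacian_matrix G vs *\<^sub>v vec ?n (\<lambda>i. \<phi> (vs ! i))) $ i)"
    using laplacian_carrier
    by (auto simp: scalar_prod_def[of "vec _ _" "_ *\<^sub>v _"] atLeast0LessThan
      simp del: index_mult_mat_vec intro!: sum.cong)
  also have "\<dots> = (\<Sum>i<?n. \<phi> (vs ! i) * (\<Sum>v\<in>?V. ?w (vs ! i) v * (\<phi> (vs ! i) - \<phi> v)))"
    by (intro sum.cong) (auto simp: laplacian_mult simp del: index_mult_mat_vec)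
  also have "\<dots> = (\<Sum>u\<in>?V. \<phi> u * (\<Sum>v\<in>?V. ?w u v * (\<phi> u - \<phi> v)))" by (rule sum_enum)
  also have "\<dots> = a - b"
    by (simp add: a_def b_def sum_distrib_left sum_subtractf[symmetric] algebra_simps)
  also have "\<dots> = dirichlet_energy ?w ?V \<phi>"
  proof -
    \<comment> \<open>Symmetry of the weights identifies the sum of the \<open>\<phi> v\<close>
      squares with the degree part \<open>a\<close>; expanding the square then gives twice the
      energy as \<open>2 * a - 2 * b\<close>.\<close>
    have "(\<Sum>u\<in>?V. \<Sum>v\<in>?V. ?w u v * (\<phi> v * \<phi> v)) = (\<Sum>v\<in>?V. \<Sum>u\<in>?V. ?w u v * (\<phi> v * \<phi> v))"
      by (rule sum.swap)
    also have "\<dots> = a" unfolding a_def by (intro sum.cong refl) (simp add: edge_weight_sym)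
    finally have a': "(\<Sum>u\<in>?V. \<Sum>v\<in>?V. ?w u v * (\<phi> v * \<phi> v)) = a" .
    have "2 * dirichlet_energy ?w ?V \<phi> = (\<Sum>u\<in>?V. \<Sum>v\<in>?V.
        ?w u v * (\<phi> u * \<phi> u) + ?w u v * (\<phi> v * \<phi> v) - 2 * (?w u v * (\<phi> u * \<phi> v)))"
      unfolding dirichlet_energy_def by (simp add: power2_eq_square algebra_simps)
    also have "\<dots> = a + a - 2 * b"
      by (simp add: sum_subtractf sum.distrib a' a_def[symmetric] b_def[symmetric] sum_distrib_left[symmetric])
    finally show ?thesis by simp
  qed
  finally show ?thesis .
qed

end

end

section \<open>Spectral bounds on the Dirichlet energy and the separation into components\<close>

context graph
begin

context
  fixes vs :: "'a list" and \<mu> :: "nat \<Rightarrow> real"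
  assumes vs: "distinct vs" "set vs = verts G" and n2: "card (verts G) \<ge> 2"
  defines "\<mu> \<equiv> laplacian_eigenvalue G vs"
begin

lemma enum_dot:
  "vec (length vs) (\<lambda>i. \<phi> (vs ! i)) \<bullet> vec (length vs) (\<lambda>i. \<psi> (vs ! i)) = (\<Sum>u\<in>verts G. \<phi> u * \<psi> u)"
proof -
  have "vec (length vs) (\<lambda>i. \<phi> (vs ! i)) \<bullet> vec (length vs) (\<lambda>i. \<psi> (vs ! i))
      = (\<Sum>i<length vs. \<phi> (vs ! i) * \<psi> (vs ! i))"
    by (simp add: scalar_prod_def atLeast0LessThan)
  then show ?thesis by (simp add: sum_enum[OF vs, of "\<lambda>u. \<phi> u * \<psi> u"])
qed

lemma dirichlet_energy_le_last:
  "dirichlet_energy (edge_weight G) (verts G) \<phi> \<le> \<mu> (card (verts G)) * (\<Sum>u\<in>verts G. (\<phi> u)\<^sup>2)"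
  unfolding \<mu>_def laplacian_eigenvalue_def length_enum[OF vs, symmetric]
  using symmetric_real_mat_form_le_last[OF laplacian_carrier[OF vs] laplacian_sym[OF vs],
      of "vec (length vs) (\<lambda>i. \<phi> (vs ! i))"]
  by (simp add: laplacian_form[OF vs] enum_dot power2_eq_square)

text \<open>The all-ones vector lies in the kernel of the Laplacian, and the assumption says that
  \<open>\<phi>\<close> is orthogonal to it.\<close>

lemma dirichlet_energy_ge_second:
  assumes "(\<Sum>u\<in>verts G. \<phi> u) = 0"
  shows "\<mu> 2 * (\<Sum>u\<in>verts G. (\<phi> u)\<^sup>2) \<le> dirichlet_energy (edge_weight G) (verts G) \<phi>"
proof -
  let ?n = "length vs" and ?L = "laplacian_matrix G vs"
  let ?vec = "\<lambda>\<phi>. vec ?n (\<lambda>i. \<phi> (vs ! i)) :: real vec"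
  have psd: "y \<bullet> (?L *\<^sub>v y) \<ge> 0" if y: "y \<in> carrier_vec ?n" for y
  proof -
    have inj: "inj_on ((!) vs) {..<?n}" using vs(1) by (simp add: inj_on_nth)
    \<comment> \<open>Inverting the enumeration reads a vector as a function on vertices, so its
      quadratic form is an energy and hence nonnegative.\<close>
    define \<eta> where "\<eta> u = y $ (the_inv_into {..<?n} ((!) vs) u)" for u
    have y\<eta>: "y = ?vec \<eta>"
      using y by (intro eq_vecI) (auto simp: \<eta>_def the_inv_into_f_f[OF inj])
    show ?thesis unfolding y\<eta> laplacian_form[OF vs]
      by (rule dirichlet_energy_nonneg) (simp add: edge_weight_def)
  qed
  have ker: "?L *\<^sub>v ?vec (\<lambda>_. 1) = 0\<^sub>v ?n"
  proof (rule eq_vecI)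
    fix i assume "i < dim_vec (0\<^sub>v ?n :: real vec)"
    then have i: "i < ?n" by simp
    show "(?L *\<^sub>v ?vec (\<lambda>_. 1)) $ i = 0\<^sub>v ?n $ i"
      using laplacian_mult[OF vs i, of "\<lambda>_. 1"] i by simp
  qed (use laplacian_carrier[OF vs] in auto)
  have n: "?n \<ge> 2" using n2 length_enum[OF vs] by simp
  then have "0 < ?n" by linarith
  then have "?vec (\<lambda>_. 1) $ 0 \<noteq> 0\<^sub>v ?n $ 0" by simp
  then have nz: "?vec (\<lambda>_. 1) \<noteq> 0\<^sub>v ?n" by metis
  have "?vec (\<lambda>_. 1) \<bullet> ?vec \<phi> = 0" using assms enum_dot[of "\<lambda>_. 1" \<phi>] by simp
  from symmetric_real_mat_form_ge_second[OF laplacian_carrier[OF vs] laplacian_sym[OF vs] psd n _ nz ker _ this]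
  show ?thesis
    by (simp add: laplacian_form[OF vs] enum_dot \<mu>_def laplacian_eigenvalue_def power2_eq_square)
qed

text \<open>The bracket is \<open>n\<close> times the sum of squared deviations of
  \<open>\<phi>\<close> from its mean. Centring leaves the energy unchanged, so both bounds come
  from the centred function \<open>\<psi>\<close>; for the upper bound this gains the term with the
  squared sum.\<close>

lemma dirichlet_energy_bounds:
  defines "n \<equiv> real (card (verts G))"
  shows "\<mu> 2 * (n * (\<Sum>u\<in>verts G. (\<phi> u)\<^sup>2) - (\<Sum>u\<in>verts G. \<phi> u)\<^sup>2)
      \<le> n * dirichlet_energy (edge_weight G) (verts G) \<phi>" (is "?low")
    and "n * dirichlet_energy (edge_weight G) (verts G) \<phi>
      \<le> \<mu> (card (verts G)) * (n * (\<Sum>u\<in>verts G. (\<phi> u)\<^sup>2) - (\<Sum>u\<in>verts G. \<phi> u)\<^sup>2)" (is "?up")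
proof -
  have n: "n > 0" using n2 by (simp add: n_def)
  define m where "m = (\<Sum>u\<in>verts G. \<phi> u) / n"
  define \<psi> where "\<psi> u = \<phi> u - m" for u
  have m: "(\<Sum>u\<in>verts G. \<phi> u) = n * m" using n by (simp add: m_def)
  have zero: "(\<Sum>u\<in>verts G. \<psi> u) = 0" by (simp add: \<psi>_def sum_subtractf m n_def)
  have "(\<Sum>u\<in>verts G. (\<psi> u)\<^sup>2) = (\<Sum>u\<in>verts G. (\<phi> u)\<^sup>2 - 2 * m * \<phi> u + m\<^sup>2)"
    by (simp add: \<psi>_def power2_diff algebra_simps)
  also have "\<dots> = (\<Sum>u\<in>verts G. (\<phi> u)\<^sup>2) - n * m\<^sup>2"
    by (simp add: sum.distrib sum_subtractf sum_distrib_left[symmetric] m n_def power2_eq_square)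
  finally have sq0: "(\<Sum>u\<in>verts G. (\<psi> u)\<^sup>2) = (\<Sum>u\<in>verts G. (\<phi> u)\<^sup>2) - n * m\<^sup>2" .
  have sq: "n * (\<Sum>u\<in>verts G. (\<psi> u)\<^sup>2) = n * (\<Sum>u\<in>verts G. (\<phi> u)\<^sup>2) - (\<Sum>u\<in>verts G. \<phi> u)\<^sup>2"
    unfolding sq0 m by (simp add: power2_eq_square algebra_simps)
  have en: "dirichlet_energy (edge_weight G) (verts G) \<psi> = dirichlet_energy (edge_weight G) (verts G) \<phi>"
    unfolding \<psi>_def by (rule dirichlet_energy_shift)
  show ?low
    using mult_left_mono[OF dirichlet_energy_ge_second[OF zero], of n] n
    unfolding sq[symmetric] en by (simp add: mult.left_commute)
  show ?up
    using mult_left_mono[OF dirichlet_energy_le_last[of \<psi>], of n] n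
    unfolding sq[symmetric] en by (simp add: mult.left_commute)
qed

end

text \<open>The sets are the mutual reachability classes of \<open>H\<close>. An arc of
  \<open>G\<close> between two of them would lie in \<open>H\<close> together with its opposite and
  merge the classes.\<close>

lemma component_separation:
  fixes S :: "'a set"
  defines "H \<equiv> G \<restriction> (verts G - S)"
  obtains \<C> where "\<Union>\<C> = verts G - S" "{} \<notin> \<C>" "card \<C> = card (connected_components H)"
    "\<And>A B. A \<in> \<C> \<Longrightarrow> B \<in> \<C> \<Longrightarrow> A \<noteq> B \<Longrightarrow> A \<inter> B = {}"
    "\<And>A B u v. A \<in> \<C> \<Longrightarrow> B \<in> \<C> \<Longrightarrow> A \<noteq> B \<Longrightarrow> u \<in> A \<Longrightarrow> v \<in> B \<Longrightarrow> edge_weight G u v = 0"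
proof -
  have "induced_subgraph H G" unfolding H_def by (rule induced_induce) auto
  then interpret H: sym_digraph H by (rule induced_graph_imp_graph)
  have vH: "verts H = verts G - S" by (simp add: H_def)
  show thesis
  proof
    show Un: "\<Union>H.sccs_verts = verts G - S"
      unfolding vH[symmetric] using H.sccs_verts_subsets H.in_scc_of_self H.scc_of_in_sccs_verts by blast
    show "{} \<notin> H.sccs_verts" by (simp add: H.in_sccs_verts_conv_reachable)
    show "card H.sccs_verts = card (connected_components H)"
      by (simp add: H.card_sccs_verts H.connected_components_eq_sccs)
    show "A \<inter> B = {}" if "A \<in> H.sccs_verts" "B \<in> H.sccs_verts" "A \<noteq> B" for A B
      using that by (rule H.sccs_verts_disjoint)
    fix A B u v
    assume AB: "A \<in> H.sccs_verts" "B \<in> H.sccs_verts" "A \<noteq> B" and uv: "u \<in> A" "v \<in> B"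
    have "v \<notin> A" using H.sccs_verts_disjoint[OF AB] uv by blast
    then have nr: "\<not> u \<rightarrow>\<^sup>*\<^bsub>H\<^esub> v \<or> \<not> v \<rightarrow>\<^sup>*\<^bsub>H\<^esub> u" using AB(1) uv(1) by (simp add: H.in_sccs_verts_conv_reachable)
    have "\<not> u \<rightarrow>\<^bsub>G\<^esub> v"
    proof
      assume "u \<rightarrow>\<^bsub>G\<^esub> v"
      moreover have "u \<in> verts G - S" "v \<in> verts G - S" using Un AB uv by blast+
      ultimately have "u \<rightarrow>\<^bsub>H\<^esub> v" by (auto simp: H_def arcs_ends_conv)
      then have "u \<rightarrow>\<^sup>*\<^bsub>H\<^esub> v" "v \<rightarrow>\<^sup>*\<^bsub>H\<^esub> u"
        using H.reachable_adjI arcs_ends_symmetric[OF H.sym_arcs] by blast+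
      with nr show False by blast
    qed
    then show "edge_weight G u v = 0" by (simp add: edge_weight_def)
  qed
qed

end

section \<open>From the eigenvalue inequality to toughness\<close>

theorem theorem4:
  fixes G :: "('a, 'b) pre_digraph" and vs :: "'a list" and r :: real
  assumes "graph G"
    and "arcs G \<noteq> {}"
    and "distinct vs" and "set vs = verts G"
    and "r \<ge> 0"
    and "laplacian_eigenvalue G vs 2 / laplacian_eigenvalue G vs (card (verts G)) \<ge> r / (r + 1)"
  shows "tough r G"
proof -
  interpret graph G by fact
  let ?w = "edge_weight G" and ?V = "verts G"
  let ?\<mu> = "laplacian_eigenvalue G vs"
  let ?n = "card ?V"
  note vs = assms(3,4)
  obtain e where "e \<in> arcs G" using assms(2) by blast
  then have "{tail G e, head G e} \<subseteq> ?V" "tail G e \<noteq> head G e" using no_loops by auto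
  then have n2: "?n \<ge> 2" by (metis card_2_iff card_mono finite_verts)
  \<comment> \<open>A constant function has zero energy, which forces the last eigenvalue to be
    nonnegative.\<close>
  have "0 \<le> ?\<mu> ?n * (\<Sum>u\<in>?V. 1\<^sup>2)"
    using dirichlet_energy_le_last[OF vs n2, of "\<lambda>_. 1"] by (simp add: dirichlet_energy_def)
  then have last: "?\<mu> ?n \<ge> 0" using n2 by (auto simp: zero_le_mult_iff)
  have "r \<le> card S / card (connected_components (G \<restriction> (?V - S)))"
    if S: "S \<subset> ?V" and c: "card (connected_components (G \<restriction> (?V - S))) > 1" for S
  \<comment> \<open>For \<open>r = 0\<close> the bound is trivial. For \<open>r > 0\<close> the
    ratio is positive, so, division by zero being zero, \<open>?\<mu> ?n\<close> is not zero and
    both eigenvalues are positive.\<close>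
  proof (cases "r = 0")
    case False
    then have "0 < r / (r + 1)" using assms(5) by simp
    then have "0 < ?\<mu> 2 / ?\<mu> ?n" using assms(6) by linarith
    then have pos: "?\<mu> ?n > 0" "?\<mu> 2 > 0" using last by (auto simp: zero_less_divide_iff)
    then have ratio: "r * ?\<mu> ?n \<le> (r + 1) * ?\<mu> 2"
      using assms(5,6) by (simp add: field_simps)
    define s where "s = real (card S)"
    define k where "k = real (card (connected_components (G \<restriction> (?V - S))))"
    obtain \<C> where \<C>: "\<Union>\<C> = ?V - S" "{} \<notin> \<C>" "card \<C> = card (connected_components (G \<restriction> (?V - S)))"
      "\<And>A B. A \<in> \<C> \<Longrightarrow> B \<in> \<C> \<Longrightarrow> A \<noteq> B \<Longrightarrow> A \<inter> B = {}"
      "\<And>A B u v. A \<in> \<C> \<Longrightarrow> B \<in> \<C> \<Longrightarrow> A \<noteq> B \<Longrightarrow> u \<in> A \<Longrightarrow> v \<in> B \<Longrightarrow> ?w u v = 0"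
      using component_separation[of S] by blast
    have "real (card S + card \<C>) * ?\<mu> 2 \<le> real (card S) * ?\<mu> ?n"
    proof (rule separation_bound[where w = ?w, OF finite_verts _ \<C>(1,2) _ \<C>(4,5)])
      show "?w u v = ?w v u" for u v by (rule edge_weight_sym)
    qed (use S c \<C>(3) pos dirichlet_energy_bounds[OF vs n2] in auto)
    then have "(s + k) * ?\<mu> 2 \<le> s * ?\<mu> ?n" by (simp add: s_def k_def \<C>(3))
    \<comment> \<open>After multiplication by \<open>r\<close>, the ratio bound replaces
      \<open>r * ?\<mu> ?n\<close> by \<open>(r + 1) * ?\<mu> 2\<close>; cancelling
      \<open>?\<mu> 2\<close> and \<open>r * s\<close> leaves \<open>r * k \<le> s\<close>.\<close>
    from mult_left_mono[OF this assms(5)]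
    have "r * (s + k) * ?\<mu> 2 \<le> s * (r * ?\<mu> ?n)" by (simp add: mult.assoc mult.left_commute)
    also have "\<dots> \<le> s * ((r + 1) * ?\<mu> 2)" using ratio by (intro mult_left_mono) (auto simp: s_def)
    finally have "(r * (s + k)) * ?\<mu> 2 \<le> (s * (r + 1)) * ?\<mu> 2" by (simp add: mult.assoc)
    then have "r * (s + k) \<le> s * (r + 1)" using pos by simp
    then have "r * k \<le> s" by (simp add: algebra_simps)
    then show ?thesis using c by (simp add: s_def k_def pos_le_divide_eq)
  qed simp
  \<comment> \<open>A lower bound on every ratio bounds the infimum, including the empty one of a
    complete graph, which is infinite.\<close>
  then show ?thesis unfolding tough_def toughness_def by (intro INF_greatest) simp
qed

end
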